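(* Let $m,n,l\ge 1$ be integers, let $\mathcal X=\{\mathbf x^{(1)},\dots,\mathbf x^{(l)}\}$ with $\mathbf x^{(i)}\in\mathbb R^n$ and $\mathcal Y=\{\mathbf y^{(1)},\dots,\mathbf y^{(l)}\}$ with $\mathbf y^{(i)}\in\mathbb R^m$, $1\le i\le l$, be given, and let $\beta>0$ and $s\neq 0$ be real numbers. Let $\psi(\mathcal X,\mathcal Y,\beta,s,t)$, $t\in[0,1]$, be the interpolating function defined in the context. Then for every $t\in[0,1]$ $$\psi(\mathcal X,\mathcal Y,\beta,s,t)=\psi(\mathcal X,\mathcal Y,\beta,s,0)+\int_0^t\frac{d\psi(\mathcal X,\mathcal Y,\beta,s,\tau)}{d\tau}\,d\tau,$$ and the following comparison principle holds: $$\psi(\mathcal X,\mathcal Y,\beta,s,0)\ \ge\ \psi(\mathcal X,\mathcal Y,\beta,s,t)\ \ge\ \psi(\mathcal X,\mathcal Y,\beta,s,1).$$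
   Context: $G\in\mathbb R^{m\times n}$, $u^{(4)}\in\mathbb R$, $\mathbf u^{(2)}\in\mathbb R^m$, $\mathbf h\in\mathbb R^n$ have i.i.d. standard normal components and are independent of each other. For $t\in[0,1]$, $$\psi(\mathcal X,\mathcal Y,\beta,s,t)=\mathbb E_{G,u^{(4)},\mathbf u^{(2)},\mathbf h}\,\frac{1}{\beta|s|\sqrt n}\log\left(\sum_{i_1=1}^{l}\left(\sum_{i_2=1}^{l}e^{\beta H_t^{(i_1,i_2)}}\right)^{s}\right),$$ $$H_t^{(i_1,i_2)}=\sqrt t\,(\mathbf y^{(i_2)})^TG\mathbf x^{(i_1)}+\sqrt{1-t}\,\|\mathbf x^{(i_1)}\|_2(\mathbf y^{(i_2)})^T\mathbf u^{(2)}+\sqrt t\,\|\mathbf x^{(i_1)}\|_2\|\mathbf y^{(i_2)}\|_2\,u^{(4)}+\sqrt{1-t}\,\|\mathbf y^{(i_2)}\|_2\,\mathbf h^T\mathbf x^{(i_1)}.$$ The derivative $d\psi/d\tau$ in the integrand is taken on $(0,1)$. *)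

theory Defs
  imports "HOL-Probability.Probability"
begin

text \<open>One index for each scalar entry of \<open>G\<close>, \<open>u4\<close>, \<open>u2\<close> and \<open>h\<close>, so that independence
  within and between the four Gaussian objects is independence of a single family.\<close>

datatype ('m, 'n) gauss_index = Entry_G 'm 'n | Entry_u4 | Entry_u2 'm | Entry_h 'n

definition gauss_entry ::
    "('w \<Rightarrow> real ^ 'n ^ 'm) \<Rightarrow> ('w \<Rightarrow> real) \<Rightarrow> ('w \<Rightarrow> real ^ 'm) \<Rightarrow> ('w \<Rightarrow> real ^ 'n) \<Rightarrow>
     ('m, 'n) gauss_index \<Rightarrow> 'w \<Rightarrow> real" where
  "gauss_entry G u4 u2 h k \<omega> = (case k of
      Entry_G i j \<Rightarrow> G \<omega> $ i $ j
    | Entry_u4 \<Rightarrow> u4 \<omega>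
    | Entry_u2 i \<Rightarrow> u2 \<omega> $ i
    | Entry_h j \<Rightarrow> h \<omega> $ j)"

definition iid_std_normal ::
    "'w measure \<Rightarrow> ('w \<Rightarrow> real ^ 'n ^ 'm) \<Rightarrow> ('w \<Rightarrow> real) \<Rightarrow> ('w \<Rightarrow> real ^ 'm) \<Rightarrow>
     ('w \<Rightarrow> real ^ 'n) \<Rightarrow> bool" where
  "iid_std_normal M G u4 u2 h \<longleftrightarrow>
     prob_space.indep_vars M (\<lambda>_. borel) (gauss_entry G u4 u2 h) UNIV \<and>
     (\<forall>k. distributed M lborel (gauss_entry G u4 u2 h k) std_normal_density)"

definition interp_H ::
    "real ^ 'n ^ 'm \<Rightarrow> real \<Rightarrow> real ^ 'm \<Rightarrow> real ^ 'n \<Rightarrow> real \<Rightarrow> real ^ 'n \<Rightarrow> real ^ 'm \<Rightarrow> real" where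
  "interp_H G u4 u2 h t x y =
     sqrt t * (y \<bullet> (G *v x)) + sqrt (1 - t) * norm x * (y \<bullet> u2)
     + sqrt t * norm x * norm y * u4 + sqrt (1 - t) * norm y * (h \<bullet> x)"

definition log_partition ::
    "nat \<Rightarrow> (nat \<Rightarrow> real ^ 'n) \<Rightarrow> (nat \<Rightarrow> real ^ 'm) \<Rightarrow> real \<Rightarrow> real \<Rightarrow> real \<Rightarrow>
     real ^ 'n ^ 'm \<Rightarrow> real \<Rightarrow> real ^ 'm \<Rightarrow> real ^ 'n \<Rightarrow> real" where
  "log_partition l x y \<beta> s t G u4 u2 h =
     ln (\<Sum>i1 = 1..l. (\<Sum>i2 = 1..l. exp (\<beta> * interp_H G u4 u2 h t (x i1) (y i2))) powr s)"

definition psi ::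
    "'w measure \<Rightarrow> ('w \<Rightarrow> real ^ 'n ^ 'm) \<Rightarrow> ('w \<Rightarrow> real) \<Rightarrow> ('w \<Rightarrow> real ^ 'm) \<Rightarrow>
     ('w \<Rightarrow> real ^ 'n) \<Rightarrow> nat \<Rightarrow> (nat \<Rightarrow> real ^ 'n) \<Rightarrow> (nat \<Rightarrow> real ^ 'm) \<Rightarrow>
     real \<Rightarrow> real \<Rightarrow> real \<Rightarrow> real" where
  "psi M G u4 u2 h l x y \<beta> s t =
     prob_space.expectation M (\<lambda>\<omega>.
       1 / (\<beta> * \<bar>s\<bar> * sqrt (real CARD('n))) *
       log_partition l x y \<beta> s t (G \<omega>) (u4 \<omega>) (u2 \<omega>) (h \<omega>))"

end

theory Submission
  imports Defs
begin

text \<open>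
  Write the process as \<open>sqrt t P + sqrt (1 - t) Q\<close> with independent centred Gaussian fields \<open>P\<close>, \<open>Q\<close>
  indexed by pairs \<open>(i1, i2)\<close>. Differentiating under the expectation and integrating by parts in each
  Gaussian coordinate gives
  \<open>\<psi>'(t) = 1/2 \<Sum>\<^sub>a\<^sub>,\<^sub>b D(a,b) E[\<partial>\<^sub>a \<partial>\<^sub>b f]\<close>, where \<open>f\<close> is the normalised log-partition function and
  \<open>D = Cov P - Cov Q\<close>. At \<open>a = (i1, i2)\<close>, \<open>b = (j1, j2)\<close> the matrix \<open>D\<close> factors as
  \<open>(|x i1| |x j1| - x i1 \<bullet> x j1) (|y i2| |y j2| - y i2 \<bullet> y j2)\<close>, which is nonnegative by Cauchy-Schwarz
  and vanishes for \<open>i1 = j1\<close>. For \<open>i1 \<noteq> j1\<close> the mixed derivative of \<open>f\<close> is a nonpositive multiple of a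
  product of Gibbs weights, whatever the sign of \<open>s\<close>, so \<open>\<psi>\<close> decreases. The factors \<open>1 / sqrt t\<close> and
  \<open>1 / sqrt (1 - t)\<close> cancel in the integration by parts, so \<open>\<psi>'\<close> stays bounded up to the endpoints.
\<close>

section \<open>The log-partition function and its first two derivatives\<close>

locale gibbs =
  fixes I :: "'i set" and J :: "'j set" and \<beta> s :: real
  assumes finite_I: "finite I" and I_ne: "I \<noteq> {}"
    and finite_J: "finite J" and J_ne: "J \<noteq> {}"
    and beta_pos: "\<beta> > 0"
begin

definition row :: "('i \<times> 'j \<Rightarrow> real) \<Rightarrow> 'i \<Rightarrow> real" where
  "row v i = (\<Sum>j\<in>J. exp (\<beta> * v (i, j)))"

definition partition :: "('i \<times> 'j \<Rightarrow> real) \<Rightarrow> real" where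
  "partition v = (\<Sum>i\<in>I. row v i powr s)"

text \<open>Up to the factor \<open>s * \<beta>\<close> this is the gradient of
  \<open>ln (partition v)\<close>. It is a two-level Gibbs measure on \<open>I \<times> J\<close>:
  row \<open>i\<close> has probability \<open>row v i powr s / partition v\<close>, and within a row
  the mass is proportional to \<open>exp (\<beta> * v (i, j))\<close>.\<close>

definition weight :: "('i \<times> 'j \<Rightarrow> real) \<Rightarrow> 'i \<times> 'j \<Rightarrow> real" where
  "weight v a = row v (fst a) powr (s - 1) * exp (\<beta> * v a) / partition v"

text \<open>\<open>dweight v a b\<close> is the derivative of \<open>weight v a\<close> with respect to \<open>v b\<close>.\<close>

definition dweight :: "('i \<times> 'j \<Rightarrow> real) \<Rightarrow> 'i \<times> 'j \<Rightarrow> 'i \<times> 'j \<Rightarrow> real" where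
  "dweight v a b = \<beta> * weight v a *
     (of_bool (a = b) + (s - 1) * of_bool (fst a = fst b) * (exp (\<beta> * v b) / row v (fst a))
      - s * weight v b)"

section \<open>Uniform bounds on the Gibbs weights and their derivatives\<close>

lemma finite_IJ [simp]: "finite (I \<times> J)"
  using finite_I finite_J by simp

lemma row_pos: "0 < row v i"
  unfolding row_def using finite_J J_ne by (intro sum_pos) auto

lemma partition_pos: "0 < partition v"
  unfolding partition_def using finite_I I_ne row_pos[of v]
  by (intro sum_pos) (auto simp: less_imp_neq[OF row_pos, symmetric])

lemma weight_nonneg: "0 \<le> weight v a"
  unfolding weight_def using partition_pos[of v] by simp

lemma exp_le_row: "a \<in> I \<times> J \<Longrightarrow> exp (\<beta> * v a) \<le> row v (fst a)"
  unfolding row_def using finite_J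
    member_le_sum[of "snd a" J "\<lambda>j. exp (\<beta> * v (fst a, j))"]
  by (cases a) auto

text \<open>A single exponential is at most its row sum, so the numerator is at most
  \<open>row v (fst a) powr s\<close>, which is one term of the partition sum.\<close>

lemma weight_le_1:
  assumes "a \<in> I \<times> J"
  shows "weight v a \<le> 1"
proof -
  have "row v (fst a) powr (s - 1) * exp (\<beta> * v a) \<le> row v (fst a) powr (s - 1) * row v (fst a)"
    using exp_le_row[OF assms] by (intro mult_left_mono) auto
  also have "\<dots> = row v (fst a) powr s"
    using row_pos[of v "fst a"] by (simp add: powr_diff)
  also have "\<dots> \<le> partition v"
    unfolding partition_def using assms finite_I
    by (intro member_le_sum[where f = "\<lambda>i. row v i powr s"]) auto
  finally show ?thesis
    unfolding weight_def using partition_pos[of v] by simp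
qed

text \<open>The bound is independent of \<open>v\<close>; this uniformity provides the boundedness
  that Gaussian integration by parts requires.\<close>

lemma abs_dweight_le:
  assumes "a \<in> I \<times> J" "b \<in> I \<times> J"
  shows "\<bar>dweight v a b\<bar> \<le> \<beta> * (1 + \<bar>s - 1\<bar> + \<bar>s\<bar>)"
proof -
  \<comment> \<open>Up to the row indicator, \<open>q\<close> is the share of \<open>b\<close> in
    its row sum, hence at most \<open>1\<close>.\<close>
  define q where "q = of_bool (fst a = fst b) * (exp (\<beta> * v b) / row v (fst a))"
  have q: "\<bar>q\<bar> \<le> 1"
    using exp_le_row[OF assms(2), of v] row_pos[of v "fst a"] by (auto simp: q_def)
  have 1: "\<bar>of_bool (a = b) + (s - 1) * q - s * weight v b\<bar> \<le> 1 + \<bar>s - 1\<bar> + \<bar>s\<bar>"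
  proof -
    have "\<bar>(s - 1) * q\<bar> \<le> \<bar>s - 1\<bar>"
      using q by (simp add: abs_mult mult_left_le)
    moreover have "\<bar>s * weight v b\<bar> \<le> \<bar>s\<bar>"
      using weight_le_1[OF assms(2), of v] weight_nonneg[of v b] by (simp add: abs_mult mult_left_le)
    moreover have "\<bar>of_bool (a = b) :: real\<bar> \<le> 1" by simp
    ultimately show ?thesis by linarith
  qed
  have eq: "dweight v a b = (\<beta> * weight v a) * (of_bool (a = b) + (s - 1) * q - s * weight v b)"
    by (simp add: dweight_def q_def)
  have "\<bar>\<beta> * weight v a\<bar> \<le> \<beta>"
    using beta_pos weight_le_1[OF assms(1), of v] weight_nonneg[of v a]
    by (simp add: abs_mult mult_left_le)
  then show ?thesis
    unfolding eq abs_mult[of "\<beta> * weight v a"] using 1 beta_pos by (intro mult_mono) auto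
qed

text \<open>Different rows interact only through the normalisation \<open>partition v\<close>.
  Multiplied by the factor \<open>s * \<beta>\<close> of the gradient this becomes
  \<open>- (s * \<beta>)\<^sup>2\<close> times a product of weights, so the sign of \<open>s\<close>
  disappears.\<close>

lemma dweight_off_row: "fst a \<noteq> fst b \<Longrightarrow> dweight v a b = - (\<beta> * s * weight v a * weight v b)"
  by (auto simp: dweight_def)

section \<open>Derivatives along a curve of fields, later a segment, one moving Gaussian coordinate,
  or the interpolation time\<close>

context
  fixes v :: "real \<Rightarrow> 'i \<times> 'j \<Rightarrow> real" and d :: "'i \<times> 'j \<Rightarrow> real" and r :: real
  assumes path: "\<And>a. a \<in> I \<times> J \<Longrightarrow> ((\<lambda>r. v r a) has_real_derivative d a) (at r)"
begin

lemma DERIV_exp_path: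
  "a \<in> I \<times> J \<Longrightarrow> ((\<lambda>r. exp (\<beta> * v r a)) has_real_derivative exp (\<beta> * v r a) * (\<beta> * d a)) (at r)"
  by (auto intro!: derivative_eq_intros path)

lemma DERIV_row:
  assumes "i \<in> I"
  shows "((\<lambda>r. row (v r) i) has_real_derivative (\<Sum>j\<in>J. exp (\<beta> * v r (i, j)) * (\<beta> * d (i, j)))) (at r)"
  unfolding row_def using assms by (intro DERIV_sum DERIV_exp_path) auto

lemma DERIV_row_powr:
  assumes "i \<in> I"
  shows "((\<lambda>r. row (v r) i powr p) has_real_derivative
           p * row (v r) i powr (p - 1) * (\<Sum>j\<in>J. exp (\<beta> * v r (i, j)) * (\<beta> * d (i, j)))) (at r)"
  using DERIV_fun_powr[OF DERIV_row[OF assms] row_pos, of p] by simp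

lemma DERIV_partition:
  "((\<lambda>r. partition (v r)) has_real_derivative
      partition (v r) * (s * \<beta> * (\<Sum>a\<in>I \<times> J. weight (v r) a * d a))) (at r)"
proof -
  have "((\<lambda>r. partition (v r)) has_real_derivative
      (\<Sum>i\<in>I. s * row (v r) i powr (s - 1) * (\<Sum>j\<in>J. exp (\<beta> * v r (i, j)) * (\<beta> * d (i, j))))) (at r)"
    unfolding partition_def by (intro DERIV_sum DERIV_row_powr)
  also have "(\<Sum>i\<in>I. s * row (v r) i powr (s - 1) * (\<Sum>j\<in>J. exp (\<beta> * v r (i, j)) * (\<beta> * d (i, j))))
      = partition (v r) * (s * \<beta> * (\<Sum>a\<in>I \<times> J. weight (v r) a * d a))"
    using partition_pos[of "v r"]
    by (simp add: sum.cartesian_product' sum_distrib_left weight_def mult_ac)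
  finally show ?thesis .
qed

lemma DERIV_ln_partition:
  "((\<lambda>r. ln (partition (v r))) has_real_derivative s * \<beta> * (\<Sum>a\<in>I \<times> J. weight (v r) a * d a)) (at r)"
  using DERIV_chain2[OF DERIV_ln[OF partition_pos[of "v r"]] DERIV_partition] partition_pos[of "v r"]
  by (simp add: field_simps)

lemma DERIV_weight:
  assumes a: "a \<in> I \<times> J"
  shows "((\<lambda>r. weight (v r) a) has_real_derivative (\<Sum>b\<in>I \<times> J. dweight (v r) a b * d b)) (at r)"
proof -
  \<comment> \<open>\<open>S\<close> is the derivative of the row sum containing \<open>a\<close>,
    and \<open>T\<close> is the Gibbs average of \<open>d\<close>.\<close>
  define S where "S = (\<Sum>j\<in>J. exp (\<beta> * v r (fst a, j)) * (\<beta> * d (fst a, j)))"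
  define T where "T = (\<Sum>b\<in>I \<times> J. weight (v r) b * d b)"
  let ?R = "row (v r) (fst a)" and ?Z = "partition (v r)" and ?E = "exp (\<beta> * v r a)"
  have fa: "fst a \<in> I" using a by auto
  have Z: "?Z > 0" and R: "?R > 0" by (rule partition_pos row_pos)+
  have "((\<lambda>r. weight (v r) a) has_real_derivative
      (((s - 1) * ?R powr (s - 1 - 1) * S) * ?E + (?E * (\<beta> * d a)) * ?R powr (s - 1)) / ?Z
      - (?R powr (s - 1) * ?E) * (?Z * (s * \<beta> * T)) / (?Z * ?Z)) (at r)"
    unfolding weight_def
    apply (rule DERIV_cong)
     apply (rule DERIV_divide[OF DERIV_mult[OF DERIV_row_powr[OF fa] DERIV_exp_path[OF a]] DERIV_partition])
    using Z apply simp
    using Z by (simp add: S_def T_def diff_divide_distrib add_divide_distrib)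
  also have "?R powr (s - 1 - 1) = ?R powr (s - 1) / ?R"
    using R by (simp add: powr_diff power2_eq_square)
  \<comment> \<open>Pulling out \<open>weight (v r) a\<close> leaves its logarithmic
    derivative.\<close>
  also have "(((s - 1) * (?R powr (s - 1) / ?R) * S) * ?E + (?E * (\<beta> * d a)) * ?R powr (s - 1)) / ?Z
      - (?R powr (s - 1) * ?E) * (?Z * (s * \<beta> * T)) / (?Z * ?Z)
     = weight (v r) a * ((s - 1) * S / ?R + \<beta> * d a - s * \<beta> * T)"
    using Z R by (simp add: weight_def field_simps)
  also have "\<dots> = (\<Sum>b\<in>I \<times> J. dweight (v r) a b * d b)"
  proof -
    \<comment> \<open>Indicators extend the row sum \<open>S\<close>, and below the single value
      \<open>d a\<close>, to sums over \<open>I \<times> J\<close>, so that everything can be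
      compared termwise with \<open>dweight\<close>.\<close>
    have S: "S = (\<Sum>b\<in>I \<times> J. of_bool (fst a = fst b) * (exp (\<beta> * v r b) * (\<beta> * d b)))"
    proof -
      have "(\<Sum>b\<in>I \<times> J. of_bool (fst a = fst b) * (exp (\<beta> * v r b) * (\<beta> * d b)))
        = (\<Sum>i\<in>I. \<Sum>j\<in>J. of_bool (fst a = i) * (exp (\<beta> * v r (i,j)) * (\<beta> * d (i,j))))"
        by (simp add: sum.cartesian_product case_prod_unfold)
      also have "\<dots> = (\<Sum>i\<in>I. of_bool (fst a = i) * (\<Sum>j\<in>J. (exp (\<beta> * v r (i,j)) * (\<beta> * d (i,j)))))"
        by (simp add: sum_distrib_left)
      also have "\<dots> = S"
        using fa finite_I by (simp add: S_def of_bool_def if_distrib[of "\<lambda>x. x * _"] cong: if_cong)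
      finally show ?thesis by simp
    qed
    have D: "d a = (\<Sum>b\<in>I \<times> J. of_bool (a = b) * d b)"
      using a by (simp add: of_bool_def if_distrib[of "\<lambda>x. x * _"] cong: if_cong)
    \<comment> \<open>Naming the indicators keeps them opaque while the sums are rearranged.\<close>
    define \<delta> \<rho> :: "'i \<times> 'j \<Rightarrow> real"
      where "\<delta> b = of_bool (a = b)" and "\<rho> b = of_bool (fst a = fst b)" for b
    have "(\<Sum>b\<in>I \<times> J. dweight (v r) a b * d b) = (\<Sum>b\<in>I \<times> J.
        weight (v r) a * (s - 1) / ?R * (\<rho> b * (exp (\<beta> * v r b) * (\<beta> * d b)))
        + weight (v r) a * \<beta> * (\<delta> b * d b) - weight (v r) a * s * \<beta> * (weight (v r) b * d b))"
      using R unfolding dweight_def \<delta>_def[symmetric] \<rho>_def[symmetric]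
      by (intro sum.cong refl) (simp add: field_simps)
    also have "\<dots> = weight (v r) a * (s - 1) / ?R * S + weight (v r) a * \<beta> * d a
        - weight (v r) a * s * \<beta> * T"
      unfolding S D T_def \<delta>_def[symmetric] \<rho>_def[symmetric]
      by (simp only: sum.distrib sum_subtractf sum_distrib_left)
    finally show ?thesis by (simp add: algebra_simps)
  qed
  finally show ?thesis .
qed

end

text \<open>Mean value theorem on the segment from \<open>u\<close> to \<open>v\<close>: since
  weights lie between \<open>0\<close> and \<open>1\<close>, each partial derivative is at most
  \<open>\<bar>s\<bar> * \<beta>\<close> in absolute value. All majorants for
  \<open>ln (partition v)\<close> below come from this estimate.\<close>

lemma ln_partition_Lipschitz:
  "\<bar>ln (partition v) - ln (partition u)\<bar> \<le> \<bar>s\<bar> * \<beta> * (\<Sum>a\<in>I \<times> J. \<bar>v a - u a\<bar>)"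
proof -
  define w where "w r a = u a + r * (v a - u a)" for r :: real and a
  have w_01: "w 0 = u" "w 1 = v" by (auto simp: w_def)
  have "\<exists>z>0. z < 1 \<and> ln (partition (w 1)) - ln (partition (w 0))
      = (1 - 0) * (s * \<beta> * (\<Sum>a\<in>I \<times> J. weight (w z) a * (v a - u a)))"
    by (intro MVT2 DERIV_ln_partition) (auto simp: w_def intro!: derivative_eq_intros)
  then obtain z where z: "ln (partition v) - ln (partition u)
      = s * \<beta> * (\<Sum>a\<in>I \<times> J. weight (w z) a * (v a - u a))"
    using w_01 by auto
  have "\<bar>\<Sum>a\<in>I \<times> J. weight (w z) a * (v a - u a)\<bar> \<le> (\<Sum>a\<in>I \<times> J. \<bar>v a - u a\<bar>)"
    using weight_le_1[of _ "w z"] weight_nonneg[of "w z"]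
    by (intro order_trans[OF sum_abs] sum_mono) (auto simp: abs_mult intro!: mult_left_le_one_le)
  then show ?thesis
    unfolding z using beta_pos by (simp add: abs_mult mult_left_mono)
qed

section \<open>Measurability and continuity in the field values\<close>

lemma measurable_partition:
  assumes "\<And>a. a \<in> I \<times> J \<Longrightarrow> (\<lambda>\<omega>. f \<omega> a) \<in> borel_measurable N"
  shows "(\<lambda>\<omega>. partition (f \<omega>)) \<in> borel_measurable N"
  unfolding partition_def row_def using assms by simp

lemma measurable_weight:
  assumes "\<And>a. a \<in> I \<times> J \<Longrightarrow> (\<lambda>\<omega>. f \<omega> a) \<in> borel_measurable N" "a \<in> I \<times> J"
  shows "(\<lambda>\<omega>. weight (f \<omega>) a) \<in> borel_measurable N"
proof -
  note [measurable] = measurable_partition[OF assms(1)] assms(1)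
  have [measurable]: "(\<lambda>\<omega>. row (f \<omega>) (fst a)) \<in> borel_measurable N"
    unfolding row_def using assms by (cases a) auto
  have [measurable]: "(\<lambda>\<omega>. f \<omega> a) \<in> borel_measurable N" using assms by auto
  show ?thesis unfolding weight_def by measurable
qed

lemma measurable_dweight:
  assumes "\<And>a. a \<in> I \<times> J \<Longrightarrow> (\<lambda>\<omega>. f \<omega> a) \<in> borel_measurable N" "a \<in> I \<times> J" "b \<in> I \<times> J"
  shows "(\<lambda>\<omega>. dweight (f \<omega>) a b) \<in> borel_measurable N"
proof -
  note [measurable] = measurable_weight[OF assms(1)]
  have [measurable]: "(\<lambda>\<omega>. row (f \<omega>) (fst a)) \<in> borel_measurable N"
    unfolding row_def using assms by (cases a) auto
  have [measurable]: "(\<lambda>\<omega>. f \<omega> b) \<in> borel_measurable N" using assms by auto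
  show ?thesis unfolding dweight_def using assms by measurable
qed

lemma tendsto_row:
  assumes "\<And>a. a \<in> I \<times> J \<Longrightarrow> ((\<lambda>r. v r a) \<longlongrightarrow> u a) F" "i \<in> I"
  shows "((\<lambda>r. row (v r) i) \<longlongrightarrow> row u i) F"
  unfolding row_def using assms by (intro tendsto_intros) auto

lemma tendsto_partition:
  assumes "\<And>a. a \<in> I \<times> J \<Longrightarrow> ((\<lambda>r. v r a) \<longlongrightarrow> u a) F"
  shows "((\<lambda>r. partition (v r)) \<longlongrightarrow> partition u) F"
  unfolding partition_def using row_pos[of u]
  by (intro tendsto_sum tendsto_powr tendsto_row assms tendsto_const) (auto simp: less_imp_neq[symmetric])

lemma tendsto_weight:
  assumes "\<And>a. a \<in> I \<times> J \<Longrightarrow> ((\<lambda>r. v r a) \<longlongrightarrow> u a) F" "a \<in> I \<times> J"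
  shows "((\<lambda>r. weight (v r) a) \<longlongrightarrow> weight u a) F"
  unfolding weight_def using row_pos[of u "fst a"] partition_pos[of u] assms(2)
  by (intro tendsto_intros tendsto_partition tendsto_row assms) auto

lemma tendsto_dweight:
  assumes "\<And>a. a \<in> I \<times> J \<Longrightarrow> ((\<lambda>r. v r a) \<longlongrightarrow> u a) F" "a \<in> I \<times> J" "b \<in> I \<times> J"
  shows "((\<lambda>r. dweight (v r) a b) \<longlongrightarrow> dweight u a b) F"
  unfolding dweight_def using row_pos[of u "fst a"] assms(2)
  by (intro tendsto_intros tendsto_weight tendsto_row assms) auto

end

section \<open>Gaussian integration by parts\<close>

lemma prob_space_std_normal: "prob_space std_normal_distribution"
  by (rule prob_space_normal_density) simp

lemma integrable_std_normal_id: "integrable std_normal_distribution (\<lambda>x. x)"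
  using integrable_std_normal_moment[of 1] by (simp add: integrable_density)

lemma DERIV_std_normal_density:
  "(std_normal_density has_real_derivative - x * std_normal_density x) (at x)"
  unfolding std_normal_density_def
  by (auto intro!: derivative_eq_intros simp: field_simps)

lemma std_normal_density_at_top: "(std_normal_density \<longlongrightarrow> 0) at_top"
  unfolding std_normal_density_def by real_asymp

lemma std_normal_density_at_bot: "(std_normal_density \<longlongrightarrow> 0) at_bot"
  unfolding std_normal_density_def by real_asymp

lemma integrable_std_normal_bounded:
  fixes f :: "real \<Rightarrow> real"
  assumes "f \<in> borel_measurable borel" "\<And>x. \<bar>f x\<bar> \<le> B"
  shows "integrable std_normal_distribution f"
proof -
  interpret prob_space std_normal_distribution by (rule prob_space_std_normal)
  show ?thesis using assms by (intro integrable_const_bound[where B = B]) auto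
qed

text \<open>The function \<open>std_normal_density x * f x\<close> has derivative
  \<open>std_normal_density x * (f' x - x * f x)\<close> and tends to \<open>0\<close> at both
  infinities because \<open>f\<close> is bounded, so this derivative integrates to \<open>0\<close>
  over the line.\<close>

lemma Stein_identity:
  fixes f f' :: "real \<Rightarrow> real"
  assumes deriv: "\<And>x. (f has_real_derivative f' x) (at x)"
    and cont: "continuous_on UNIV f'"
    and f_bound: "\<And>x. \<bar>f x\<bar> \<le> B" and f'_bound: "\<And>x. \<bar>f' x\<bar> \<le> B'"
  shows "(\<integral>x. x * f x \<partial>std_normal_distribution) = (\<integral>x. f' x \<partial>std_normal_distribution)"
proof -
  let ?\<phi> = "std_normal_density"
  have f_cont: "continuous_on UNIV f"
    using deriv by (meson DERIV_continuous continuous_at_imp_continuous_on)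
  have [measurable]: "f \<in> borel_measurable borel" "f' \<in> borel_measurable borel"
    using f_cont cont by (auto intro: borel_measurable_continuous_onI)
  \<comment> \<open>Since \<open>f\<close> is bounded by \<open>B\<close>, the absolute first moment
    of the normal law dominates.\<close>
  have int1: "integrable lborel (\<lambda>x. ?\<phi> x * (x * f x))"
  proof (rule Bochner_Integration.integrable_bound)
    show "integrable lborel (\<lambda>x. B * (?\<phi> x * \<bar>x\<bar> ^ 1))"
      by (intro integrable_mult_right integrable_std_normal_moment_abs)
    show "AE x in lborel. norm (?\<phi> x * (x * f x)) \<le> norm (B * (?\<phi> x * \<bar>x\<bar> ^ 1))"
    proof (rule AE_I2)
      fix x
      have "\<bar>?\<phi> x * (x * f x)\<bar> = \<bar>f x\<bar> * (?\<phi> x * \<bar>x\<bar>)" by (simp add: abs_mult)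
      also have "\<dots> \<le> B * (?\<phi> x * \<bar>x\<bar>)" by (intro mult_right_mono f_bound) auto
      finally show "norm (?\<phi> x * (x * f x)) \<le> norm (B * (?\<phi> x * \<bar>x\<bar> ^ 1))" by simp
    qed
  qed simp
  have int2: "integrable lborel (\<lambda>x. ?\<phi> x * f' x)"
    using integrable_std_normal_bounded[OF _ f'_bound] by (simp add: integrable_density)
  let ?g = "\<lambda>x. ?\<phi> x * f' x - ?\<phi> x * (x * f x)"
  have int: "integrable lborel ?g" using int1 int2 by simp
  have "(LBINT x=-\<infinity>..\<infinity>. ?g x) = 0 - 0"
  proof (rule interval_integral_FTC_integrable[where F = "\<lambda>x. ?\<phi> x * f x"])
    show "((\<lambda>x. ?\<phi> x * f x) has_vector_derivative ?g x) (at x)" for x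
      unfolding has_real_derivative_iff_has_vector_derivative[symmetric]
      by (auto intro!: derivative_eq_intros DERIV_std_normal_density deriv simp: algebra_simps)
    have "isCont ?\<phi> x" for x using DERIV_std_normal_density by (rule DERIV_isCont)
    moreover have "isCont f x" "isCont f' x" for x
      using f_cont cont by (auto simp: continuous_on_eq_continuous_at)
    ultimately show "isCont ?g x" for x by (intro continuous_intros) auto
    show "set_integrable lborel (einterval (- \<infinity>) \<infinity>) ?g"
      using int by (simp add: set_integrable_def)
    have top: "((\<lambda>x. ?\<phi> x * f x) \<longlongrightarrow> 0) at_top"
      by (rule Lim_null_comparison[OF _ tendsto_mult_right_zero[OF std_normal_density_at_top, of B]])
         (auto simp: abs_mult mult.commute intro!: always_eventually mult_right_mono f_bound)
    have bot: "((\<lambda>x. ?\<phi> x * f x) \<longlongrightarrow> 0) at_bot"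
      by (rule Lim_null_comparison[OF _ tendsto_mult_right_zero[OF std_normal_density_at_bot, of B]])
         (auto simp: abs_mult mult.commute intro!: always_eventually mult_right_mono f_bound)
    show "(((\<lambda>x. ?\<phi> x * f x) \<circ> real_of_ereal) \<longlongrightarrow> 0) (at_right (- \<infinity>))"
      using bot by (simp add: ereal_tendsto_simps)
    show "(((\<lambda>x. ?\<phi> x * f x) \<circ> real_of_ereal) \<longlongrightarrow> 0) (at_left \<infinity>)"
      using top by (simp add: ereal_tendsto_simps)
  qed simp
  then have "integral\<^sup>L lborel ?g = 0"
    by (simp add: interval_lebesgue_integral_def set_lebesgue_integral_def)
  then show ?thesis
    using int1 int2 by (simp add: integral_density)
qed

text \<open>The canonical model for all scalar Gaussian entries: coordinates are independent by
  construction, and Fubini can isolate any one of them. Expectations over the original probability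
  space are transported here at the end.\<close>

definition gauss_space :: "('k::finite \<Rightarrow> real) measure" where
  "gauss_space = PiM UNIV (\<lambda>_. std_normal_distribution)"

interpretation gauss_product: product_prob_space "\<lambda>_::'k. std_normal_distribution" UNIV
  by (intro product_prob_spaceI prob_space_std_normal)

interpretation gauss: prob_space gauss_space
  unfolding gauss_space_def by (rule prob_space_PiM) (rule prob_space_std_normal)

lemma measurable_gauss_coord [measurable]: "(\<lambda>g. g k) \<in> borel_measurable gauss_space"
  unfolding gauss_space_def
  using measurable_component_singleton[of k UNIV "\<lambda>_. std_normal_distribution"] by simp

lemma integrable_gauss_coord: "integrable gauss_space (\<lambda>g. g k)"
proof -
  have "distr gauss_space std_normal_distribution (\<lambda>g. g k) = std_normal_distribution"
    unfolding gauss_space_def by (rule distr_PiM_component) (auto simp: prob_space_std_normal)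
  then have "integrable (distr gauss_space std_normal_distribution (\<lambda>g. g k)) (\<lambda>x. x)"
    by (simp add: integrable_std_normal_id)
  then show ?thesis by (subst (asm) integrable_distr_eq) auto
qed

text \<open>Fubini freezes all coordinates except \<open>k\<close>; the inner integral is then the
  one-dimensional Stein identity. The bounds are uniform in \<open>g\<close>, so they apply to every
  slice.\<close>

lemma gauss_integration_by_parts:
  fixes f f' :: "('k::finite \<Rightarrow> real) \<Rightarrow> real"
  assumes [measurable]: "f \<in> borel_measurable gauss_space" "f' \<in> borel_measurable gauss_space"
    and deriv: "\<And>g x. ((\<lambda>x. f (g(k := x))) has_real_derivative f' (g(k := x))) (at x)"
    and cont: "\<And>g. continuous_on UNIV (\<lambda>x. f' (g(k := x)))"
    and f_bound: "\<And>g. \<bar>f g\<bar> \<le> B" and f'_bound: "\<And>g. \<bar>f' g\<bar> \<le> B'"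
  shows "integrable gauss_space (\<lambda>g. g k * f g)"
    and "(\<integral>g. g k * f g \<partial>gauss_space) = (\<integral>g. f' g \<partial>gauss_space)"
proof -
  let ?N = "\<lambda>_::'k. std_normal_distribution"
  show int: "integrable gauss_space (\<lambda>g. g k * f g)"
  proof (rule Bochner_Integration.integrable_bound)
    show "integrable gauss_space (\<lambda>g. g k * B)"
      by (intro integrable_mult_left integrable_gauss_coord)
    have "\<bar>f g\<bar> \<le> \<bar>B\<bar>" for g using f_bound[of g] by linarith
    then show "AE g in gauss_space. norm (g k * f g) \<le> norm (g k * B)"
      by (auto simp: abs_mult intro!: mult_left_mono)
  qed simp
  have int': "integrable gauss_space f'"
    using f'_bound by (intro gauss.integrable_const_bound[where B = B']) auto
  have U: "UNIV = insert k (UNIV - {k})" by auto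
  have fubini: "(\<integral>g. F g \<partial>gauss_space) = (\<integral>g. (\<integral>x. F (g(k := x)) \<partial>std_normal_distribution) \<partial>PiM (UNIV - {k}) ?N)"
    if "integrable gauss_space F" for F :: "('k \<Rightarrow> real) \<Rightarrow> real"
    using gauss_product.product_integral_insert[of "UNIV - {k}" k F] that
    unfolding gauss_space_def U[symmetric] by simp
  show "(\<integral>g. g k * f g \<partial>gauss_space) = (\<integral>g. f' g \<partial>gauss_space)"
    unfolding fubini[OF int] fubini[OF int']
    using Stein_identity[OF deriv cont f_bound f'_bound] by simp
qed

section \<open>Expected log-partition function of a Gaussian field\<close>

text \<open>Dominated convergence for a real parameter, reduced to sequences by the sequential
  description of limits within a set.\<close>

lemma tendsto_integral_dominated:
  fixes f :: "real \<Rightarrow> 'a \<Rightarrow> real"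
  assumes "\<And>r. f r \<in> borel_measurable N" "F \<in> borel_measurable N" "integrable N w"
    and lim: "\<And>\<omega>. ((\<lambda>r. f r \<omega>) \<longlongrightarrow> F \<omega>) (at x within S)"
    and bound: "\<forall>\<^sub>F r in at x within S. \<forall>\<omega>. \<bar>f r \<omega>\<bar> \<le> w \<omega>"
  shows "((\<lambda>r. \<integral>\<omega>. f r \<omega> \<partial>N) \<longlongrightarrow> (\<integral>\<omega>. F \<omega> \<partial>N)) (at x within S)"
  unfolding tendsto_at_iff_sequentially comp_def
proof (intro allI impI)
  fix X :: "nat \<Rightarrow> real"
  assume X: "\<forall>i. X i \<in> S - {x}" "X \<longlonglongrightarrow> x"
  then have lim_X: "filterlim X (at x within S) sequentially"
    by (auto simp: filterlim_at intro!: always_eventually)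
  from filterlim_iff[THEN iffD1, OF this, rule_format, OF bound]
  obtain n0 where n0: "\<And>n \<omega>. n0 \<le> n \<Longrightarrow> \<bar>f (X n) \<omega>\<bar> \<le> w \<omega>"
    by (auto simp: eventually_sequentially)
  show "(\<lambda>n. \<integral>\<omega>. f (X n) \<omega> \<partial>N) \<longlonglongrightarrow> (\<integral>\<omega>. F \<omega> \<partial>N)"
  \<comment> \<open>The majorant is available only from index \<open>n0\<close> on, so the sequence
    is shifted.\<close>
  proof (rule LIMSEQ_offset[where k = n0], rule integral_dominated_convergence)
    show "AE \<omega> in N. norm (f (X (n + n0)) \<omega>) \<le> w \<omega>" for n
      using n0 by auto
    show "AE \<omega> in N. (\<lambda>n. f (X (n + n0)) \<omega>) \<longlonglongrightarrow> F \<omega>"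
      by (intro AE_I2 LIMSEQ_ignore_initial_segment filterlim_compose[OF lim lim_X])
  qed (use assms in auto)
qed

text \<open>Under \<open>gauss_space\<close> this is a centred Gaussian field with covariance
  \<open>(\<Sum>k\<in>UNIV. c a k * c b k)\<close>. Coding a field by its coefficients puts all time
  dependence into \<open>c\<close>, while the underlying measure stays fixed.\<close>

definition gauss_field :: "('a \<Rightarrow> 'k::finite \<Rightarrow> real) \<Rightarrow> ('k \<Rightarrow> real) \<Rightarrow> 'a \<Rightarrow> real" where
  "gauss_field c g a = (\<Sum>k\<in>UNIV. c a k * g k)"

lemma measurable_gauss_field [measurable]: "(\<lambda>g. gauss_field c g a) \<in> borel_measurable gauss_space"
  unfolding gauss_field_def by measurable

lemma gauss_field_diff: "gauss_field c g a - gauss_field c' g a = gauss_field (\<lambda>a k. c a k - c' a k) g a"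
  unfolding gauss_field_def by (simp add: sum_subtractf algebra_simps)

lemma abs_gauss_field_le: "\<bar>gauss_field c g a\<bar> \<le> (\<Sum>k\<in>UNIV. \<bar>c a k\<bar> * \<bar>g k\<bar>)"
  unfolding gauss_field_def by (rule order_trans[OF sum_abs]) (simp add: abs_mult)

lemma DERIV_gauss_field_coord:
  "((\<lambda>x. gauss_field c (g(k := x)) a) has_real_derivative c a k) (at x)"
proof -
  have "((\<lambda>x. gauss_field c (g(k := x)) a) has_real_derivative (\<Sum>k'\<in>UNIV. c a k' * (if k' = k then 1 else 0))) (at x)"
    unfolding gauss_field_def by (intro DERIV_sum DERIV_cmult) auto
  then show ?thesis by (simp add: if_distrib cong: if_cong)
qed

lemma tendsto_gauss_field:
  assumes "\<And>k. ((\<lambda>r. c r a k) \<longlongrightarrow> c' a k) F"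
  shows "((\<lambda>r. gauss_field (c r) g a) \<longlongrightarrow> gauss_field c' g a) F"
  unfolding gauss_field_def using assms by (intro tendsto_intros)

context gibbs
begin

section \<open>Domination and integration by parts for Gaussian fields\<close>

lemma measurable_partition_field [measurable]:
  "(\<lambda>g. partition (gauss_field c g)) \<in> borel_measurable gauss_space"
  by (rule measurable_partition) simp

lemma measurable_weight_field:
  "a \<in> I \<times> J \<Longrightarrow> (\<lambda>g. weight (gauss_field c g) a) \<in> borel_measurable gauss_space"
  by (rule measurable_weight) simp

lemma measurable_dweight_field:
  "a \<in> I \<times> J \<Longrightarrow> b \<in> I \<times> J \<Longrightarrow> (\<lambda>g. dweight (gauss_field c g) a b) \<in> borel_measurable gauss_space"
  by (rule measurable_dweight) simp_all

text \<open>The Lipschitz estimate moved from field values to coefficients. The free bound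
  \<open>C\<close> lets one statement serve integrability, continuity and difference quotients; the
  right-hand side is linear in the \<open>\<bar>g k\<bar>\<close>, hence integrable.\<close>

lemma abs_ln_partition_field_diff_le:
  assumes "\<And>a k. a \<in> I \<times> J \<Longrightarrow> \<bar>c a k - c' a k\<bar> \<le> C a k"
  shows "\<bar>ln (partition (gauss_field c g)) - ln (partition (gauss_field c' g))\<bar>
    \<le> \<bar>s\<bar> * \<beta> * (\<Sum>a\<in>I \<times> J. \<Sum>k\<in>UNIV. C a k * \<bar>g k\<bar>)"
proof -
  have "\<bar>gauss_field c g a - gauss_field c' g a\<bar> \<le> (\<Sum>k\<in>UNIV. C a k * \<bar>g k\<bar>)" if "a \<in> I \<times> J" for a
    unfolding gauss_field_diff using assms[OF that]
    by (intro order_trans[OF abs_gauss_field_le] sum_mono mult_right_mono) auto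
  then show ?thesis
    using beta_pos by (intro order_trans[OF ln_partition_Lipschitz] mult_left_mono sum_mono) auto
qed

lemma integrable_ln_partition_bound:
  "integrable gauss_space (\<lambda>g. \<bar>s\<bar> * \<beta> * (\<Sum>a\<in>I \<times> J. \<Sum>k\<in>UNIV. C a k * \<bar>g k\<bar>))"
  by (intro integrable_mult_right Bochner_Integration.integrable_sum integrable_abs integrable_gauss_coord)

lemma integrable_ln_partition_field:
  fixes c :: "'i \<times> 'j \<Rightarrow> 'k::finite \<Rightarrow> real"
  shows "integrable gauss_space (\<lambda>g. ln (partition (gauss_field c g)))"
proof -
  \<comment> \<open>The comparison field is zero, and its log-partition function is
    constant.\<close>
  have "integrable gauss_space (\<lambda>g. ln (partition (gauss_field c g)) - ln (partition (gauss_field (\<lambda>_ _. 0) g)))"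
    by (rule Bochner_Integration.integrable_bound[OF integrable_ln_partition_bound[of "\<lambda>a k. \<bar>c a k\<bar>"]])
      (auto intro!: order_trans[OF abs_ln_partition_field_diff_le abs_ge_self])
  moreover have "integrable gauss_space (\<lambda>g::'k \<Rightarrow> real. ln (partition (gauss_field (\<lambda>_ _. 0) g)))"
    unfolding gauss_field_def by simp
  ultimately have "integrable gauss_space (\<lambda>g. (ln (partition (gauss_field c g))
      - ln (partition (gauss_field (\<lambda>_ _. 0) g))) + ln (partition (gauss_field (\<lambda>_ _. 0) g)))"
    by (rule Bochner_Integration.integrable_add)
  then show ?thesis
    by (simp only: diff_add_cancel)
qed

text \<open>Moving the coordinate \<open>g k\<close> moves field value \<open>b\<close> at speed
  \<open>c b k\<close>, so the chain rule turns the partial derivative of the weight into the sum of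
  \<open>dweight\<close> times \<open>c b k\<close>.\<close>

lemma weight_integration_by_parts:
  assumes a: "a \<in> I \<times> J"
  shows "integrable gauss_space (\<lambda>g. g k * weight (gauss_field c g) a)" (is ?int)
    and "(\<integral>g. g k * weight (gauss_field c g) a \<partial>gauss_space)
      = (\<Sum>b\<in>I \<times> J. c b k * (\<integral>g. dweight (gauss_field c g) a b \<partial>gauss_space))" (is ?eq)
proof -
  note [measurable] = measurable_weight_field[OF a] measurable_dweight_field[OF a]
  let ?f' = "\<lambda>g. \<Sum>b\<in>I \<times> J. dweight (gauss_field c g) a b * c b k"
  let ?K = "\<beta> * (1 + \<bar>s - 1\<bar> + \<bar>s\<bar>)"
  have meas': "?f' \<in> borel_measurable gauss_space"
    by measurable
  have deriv: "((\<lambda>x. weight (gauss_field c (g(k := x))) a) has_real_derivative ?f' (g(k := x))) (at x)" for g x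
    by (rule DERIV_weight[OF DERIV_gauss_field_coord a])
  have cont: "continuous_on UNIV (\<lambda>x. ?f' (g(k := x)))" for g
    unfolding continuous_on_def
    by (intro ballI tendsto_sum tendsto_mult tendsto_const tendsto_dweight[OF _ a]
        DERIV_isCont[OF DERIV_gauss_field_coord, unfolded isCont_def]) auto
  have bound: "\<bar>weight (gauss_field c g) a\<bar> \<le> 1" for g
    using weight_nonneg weight_le_1[OF a] by simp
  have bound': "\<bar>?f' g\<bar> \<le> (\<Sum>b\<in>I \<times> J. ?K * \<bar>c b k\<bar>)" for g
    by (intro order_trans[OF sum_abs] sum_mono) (auto simp: abs_mult intro!: mult_right_mono abs_dweight_le[OF a])
  have int: "integrable gauss_space (\<lambda>g. dweight (gauss_field c g) a b)" if "b \<in> I \<times> J" for b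
    using abs_dweight_le[OF a that] measurable_dweight_field[OF a that]
    by (intro gauss.integrable_const_bound[where B = ?K]) auto
  note ibp = gauss_integration_by_parts[OF measurable_weight_field[OF a] meas' deriv cont bound bound']
  show ?int by (rule ibp(1))
  show ?eq unfolding ibp(2) using int by (simp add: mult.commute)
qed

lemma tendsto_expectation_ln_partition:
  fixes c :: "real \<Rightarrow> 'i \<times> 'j \<Rightarrow> 'k::finite \<Rightarrow> real"
  assumes "\<And>a k. a \<in> I \<times> J \<Longrightarrow> ((\<lambda>t. c t a k) \<longlongrightarrow> c t0 a k) (at t0 within S)"
  shows "((\<lambda>t. \<integral>g. ln (partition (gauss_field (c t) g)) \<partial>gauss_space)
    \<longlongrightarrow> (\<integral>g. ln (partition (gauss_field (c t0) g)) \<partial>gauss_space)) (at t0 within S)"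
proof -
  \<comment> \<open>Near \<open>t0\<close> every coefficient is within \<open>1\<close> of its
    limit, which is the origin of the constant \<open>1\<close>.\<close>
  let ?w = "\<lambda>g. \<bar>ln (partition (gauss_field (c t0) g))\<bar> + \<bar>s\<bar> * \<beta> * (\<Sum>a\<in>I \<times> J. \<Sum>k\<in>UNIV. 1 * \<bar>g k\<bar>)"
  show ?thesis
  proof (rule tendsto_integral_dominated[where w = ?w])
    show "integrable gauss_space ?w"
      by (intro Bochner_Integration.integrable_add integrable_abs integrable_ln_partition_field integrable_ln_partition_bound)
    show "((\<lambda>t. ln (partition (gauss_field (c t) g))) \<longlongrightarrow> ln (partition (gauss_field (c t0) g))) (at t0 within S)" for g
      using partition_pos[of "gauss_field (c t0) g"]
      by (intro tendsto_ln tendsto_partition tendsto_gauss_field assms) auto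
    have "\<forall>\<^sub>F t in at t0 within S. \<forall>a\<in>I \<times> J. \<forall>k\<in>UNIV. \<bar>c t a k - c t0 a k\<bar> < 1"
      by (intro eventually_ball_finite ballI finite_IJ finite_UNIV
          tendstoD[OF assms, of _ 1, unfolded dist_real_def]) auto
    then show "\<forall>\<^sub>F t in at t0 within S. \<forall>g. \<bar>ln (partition (gauss_field (c t) g))\<bar> \<le> ?w g"
    proof (rule eventually_mono, intro allI)
      fix t and g :: "'k \<Rightarrow> real"
      assume "\<forall>a\<in>I \<times> J. \<forall>k\<in>UNIV. \<bar>c t a k - c t0 a k\<bar> < 1"
      then have "\<bar>ln (partition (gauss_field (c t) g)) - ln (partition (gauss_field (c t0) g))\<bar>
          \<le> \<bar>s\<bar> * \<beta> * (\<Sum>a\<in>I \<times> J. \<Sum>k\<in>UNIV. 1 * \<bar>g k\<bar>)"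
        by (intro abs_ln_partition_field_diff_le) (auto intro: less_imp_le)
      then show "\<bar>ln (partition (gauss_field (c t) g))\<bar> \<le> ?w g" by linarith
    qed
  qed simp_all
qed

text \<open>Differentiating under the expectation leaves weights times the Gaussian field with
  coefficients \<open>c'\<close>; integration by parts then trades each factor \<open>g k\<close>
  for a derivative of the weight. Only the cross covariances of \<open>c'\<close> with
  \<open>c t0\<close> remain.\<close>

lemma DERIV_expectation_ln_partition:
  fixes c' :: "'i \<times> 'j \<Rightarrow> 'k::finite \<Rightarrow> real"
  assumes c: "\<And>a k. a \<in> I \<times> J \<Longrightarrow> ((\<lambda>t. c t a k) has_real_derivative c' a k) (at t0)"
  shows "((\<lambda>t. \<integral>g. ln (partition (gauss_field (c t) g)) \<partial>gauss_space) has_real_derivative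
    s * \<beta> * (\<Sum>a\<in>I \<times> J. \<Sum>b\<in>I \<times> J. (\<Sum>k\<in>UNIV. c' a k * c t0 b k) *
      (\<integral>g. dweight (gauss_field (c t0) g) a b \<partial>gauss_space))) (at t0)"
proof -
  let ?L = "\<lambda>t g. ln (partition (gauss_field (c t) g))"
  let ?D = "\<lambda>g. s * \<beta> * (\<Sum>a\<in>I \<times> J. weight (gauss_field (c t0) g) a * gauss_field c' g a)"
  \<comment> \<open>Difference quotients of the coefficients are eventually within \<open>1\<close>
    of \<open>c' a k\<close>, hence bounded by \<open>\<bar>c' a k\<bar> + 1\<close>.\<close>
  let ?w = "\<lambda>g. \<bar>s\<bar> * \<beta> * (\<Sum>a\<in>I \<times> J. \<Sum>k\<in>UNIV. (\<bar>c' a k\<bar> + 1) * \<bar>g k\<bar>)"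
  note [measurable] = measurable_weight_field
  have lim: "((\<lambda>t. \<integral>g. (?L t g - ?L t0 g) / (t - t0) \<partial>gauss_space) \<longlongrightarrow> (\<integral>g. ?D g \<partial>gauss_space)) (at t0)"
  proof (rule tendsto_integral_dominated[where w = ?w])
    show "integrable gauss_space ?w" by (rule integrable_ln_partition_bound)
    show "((\<lambda>t. (?L t g - ?L t0 g) / (t - t0)) \<longlongrightarrow> ?D g) (at t0)" for g
    proof -
      have "((\<lambda>t. ?L t g) has_real_derivative ?D g) (at t0)"
        unfolding gauss_field_def by (intro DERIV_ln_partition DERIV_sum DERIV_cmult_right c)
      then show ?thesis unfolding has_field_derivative_iff .
    qed
    have "\<forall>\<^sub>F t in at t0. \<forall>a\<in>I \<times> J. \<forall>k\<in>UNIV. \<bar>(c t a k - c t0 a k) / (t - t0) - c' a k\<bar> < 1"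
      by (intro eventually_ball_finite ballI finite_IJ finite_UNIV
          tendstoD[OF c[unfolded has_field_derivative_iff], of _ 1, unfolded dist_real_def]) auto
    then show "\<forall>\<^sub>F t in at t0. \<forall>g. \<bar>(?L t g - ?L t0 g) / (t - t0)\<bar> \<le> ?w g"
    proof (rule eventually_mono, intro allI)
      fix t and g :: "'k \<Rightarrow> real"
      assume close: "\<forall>a\<in>I \<times> J. \<forall>k\<in>UNIV. \<bar>(c t a k - c t0 a k) / (t - t0) - c' a k\<bar> < 1"
      show "\<bar>(?L t g - ?L t0 g) / (t - t0)\<bar> \<le> ?w g"
      proof (cases "t = t0")
        \<comment> \<open>Division by zero gives the quotient the value \<open>0\<close>, and the
          majorant is nonnegative.\<close>
        case True
        then show ?thesis using beta_pos by (simp add: sum_nonneg)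
      next
        case False
        have "\<bar>c t a k - c t0 a k\<bar> \<le> \<bar>t - t0\<bar> * (\<bar>c' a k\<bar> + 1)" if "a \<in> I \<times> J" for a k
        proof -
          have "\<bar>(c t a k - c t0 a k) / (t - t0)\<bar> \<le> \<bar>c' a k\<bar> + 1"
            using close[rule_format, OF that UNIV_I, of k] by linarith
          then show ?thesis using False by (simp add: abs_divide field_simps)
        qed
        then have "\<bar>?L t g - ?L t0 g\<bar>
            \<le> \<bar>s\<bar> * \<beta> * (\<Sum>a\<in>I \<times> J. \<Sum>k\<in>UNIV. \<bar>t - t0\<bar> * (\<bar>c' a k\<bar> + 1) * \<bar>g k\<bar>)"
          by (rule abs_ln_partition_field_diff_le)
        also have "\<dots> = \<bar>t - t0\<bar> * ?w g"
          by (simp only: sum_distrib_left mult_ac)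
        finally show ?thesis using False by (simp add: abs_divide field_simps)
      qed
    qed
  qed measurable
  have quotient: "(\<integral>g. (?L t g - ?L t0 g) / (t - t0) \<partial>gauss_space)
      = ((\<integral>g. ?L t g \<partial>gauss_space) - (\<integral>g. ?L t0 g \<partial>gauss_space)) / (t - t0)" for t
    by (simp add: integrable_ln_partition_field)
  have limit: "(\<integral>g. ?D g \<partial>gauss_space) = s * \<beta> * (\<Sum>a\<in>I \<times> J. \<Sum>b\<in>I \<times> J.
      (\<Sum>k\<in>UNIV. c' a k * c t0 b k) * (\<integral>g. dweight (gauss_field (c t0) g) a b \<partial>gauss_space))"
  proof -
    have "(\<integral>g. ?D g \<partial>gauss_space) = (\<integral>g. s * \<beta> * (\<Sum>a\<in>I \<times> J. \<Sum>k\<in>UNIV.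
        c' a k * (g k * weight (gauss_field (c t0) g) a)) \<partial>gauss_space)"
      unfolding gauss_field_def[of c'] by (simp only: sum_distrib_left sum_distrib_right mult_ac)
    also have "\<dots> = s * \<beta> * (\<Sum>a\<in>I \<times> J. \<Sum>k\<in>UNIV.
        c' a k * (\<integral>g. g k * weight (gauss_field (c t0) g) a \<partial>gauss_space))"
      by (simp add: weight_integration_by_parts(1))
    also have "\<dots> = s * \<beta> * (\<Sum>a\<in>I \<times> J. \<Sum>k\<in>UNIV. \<Sum>b\<in>I \<times> J.
        c' a k * c t0 b k * (\<integral>g. dweight (gauss_field (c t0) g) a b \<partial>gauss_space))"
      by (simp add: weight_integration_by_parts(2) sum_distrib_left mult.assoc)
    finally show ?thesis
      by (simp only: sum.swap[of _ "I \<times> J" UNIV] sum_distrib_right)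
  qed
  show ?thesis
    unfolding has_field_derivative_iff using lim unfolding quotient limit .
qed

end

section \<open>Interpolation between two independent Gaussian fields\<close>

text \<open>The sign of \<open>f'\<close> yields integrability on the open interval without any
  bound near the endpoints; continuity of \<open>f\<close> on the closed interval supplies the
  boundary values. The proof passes to \<open>- f\<close> to use the version for nonnegative
  derivatives.\<close>

lemma FTC_nonpos_deriv:
  fixes f f' :: "real \<Rightarrow> real"
  assumes cont: "continuous_on {a..b} f"
    and deriv: "\<And>x. a < x \<Longrightarrow> x < b \<Longrightarrow> (f has_real_derivative f' x) (at x)"
    and cont': "continuous_on {a<..<b} f'"
    and nonpos: "\<And>x. a < x \<Longrightarrow> x < b \<Longrightarrow> f' x \<le> 0"
    and "a \<le> b"
  shows "set_integrable lborel {a<..<b} f'" and "(LBINT x:{a<..<b}. f' x) = f b - f a"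
proof -
  have "set_integrable lborel {a<..<b} f' \<and> (LBINT x:{a<..<b}. f' x) = f b - f a"
  proof (cases "a = b")
    case True
    then show ?thesis by (simp add: set_integrable_def set_lebesgue_integral_def)
  next
    case False
    with \<open>a \<le> b\<close> have "a < b" by simp
    have f_a: "((\<lambda>x. - f x) \<longlongrightarrow> - f a) (at_right a)" and f_b: "((\<lambda>x. - f x) \<longlongrightarrow> - f b) (at_left b)"
      using continuous_on_Icc_at_rightD[OF cont \<open>a < b\<close>] continuous_on_Icc_at_leftD[OF cont \<open>a < b\<close>]
      by (auto intro: tendsto_minus)
    have "set_integrable lborel (einterval (ereal a) (ereal b)) (\<lambda>x. - f' x)"
      and "(LBINT x=ereal a..ereal b. - f' x) = - f b - (- f a)"
    proof (rule_tac [!] interval_integral_FTC_nonneg[where F = "\<lambda>x. - f x"])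
      show "isCont (\<lambda>x. - f' x) x" if "ereal a < ereal x" "ereal x < ereal b" for x
        using cont' that by (auto simp: continuous_on_eq_continuous_at intro: continuous_minus)
      then show "isCont (\<lambda>x. - f' x) x" if "ereal a < ereal x" "ereal x < ereal b" for x
        using that .
    qed (use \<open>a < b\<close> deriv nonpos f_a f_b in \<open>auto simp: ereal_tendsto_simps intro!: DERIV_minus\<close>)
    then show ?thesis
      using \<open>a < b\<close> by (simp add: interval_integral_Ioo set_integrable_def set_lebesgue_integral_def)
  qed
  then show "set_integrable lborel {a<..<b} f'" and "(LBINT x:{a<..<b}. f' x) = f b - f a"
    by auto
qed

text \<open>Disjoint supports make the fields of \<open>p\<close> and \<open>q\<close> independent.
  Equality of covariances within a row removes exactly the pairs for which \<open>dweight\<close>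
  contains indicator terms and has no evident sign.\<close>

locale gauss_comparison = gibbs I J \<beta> s
  for I :: "'i set" and J :: "'j set" and \<beta> s :: real +
  fixes p q :: "'i \<times> 'j \<Rightarrow> 'k::finite \<Rightarrow> real"
  assumes disjoint_support: "p a k * q b k = 0"
    and cov_le: "(\<Sum>k\<in>UNIV. q a k * q b k) \<le> (\<Sum>k\<in>UNIV. p a k * p b k)"
    and cov_row: "fst a = fst b \<Longrightarrow> (\<Sum>k\<in>UNIV. p a k * p b k) = (\<Sum>k\<in>UNIV. q a k * q b k)"
begin

definition coef :: "real \<Rightarrow> 'i \<times> 'j \<Rightarrow> 'k \<Rightarrow> real" where
  "coef t a k = sqrt t * p a k + sqrt (1 - t) * q a k"

definition \<Psi> :: "real \<Rightarrow> real" where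
  "\<Psi> t = (\<integral>g. ln (partition (gauss_field (coef t) g)) \<partial>gauss_space)"

definition cov_diff :: "'i \<times> 'j \<Rightarrow> 'i \<times> 'j \<Rightarrow> real" where
  "cov_diff a b = (\<Sum>k\<in>UNIV. p a k * p b k) - (\<Sum>k\<in>UNIV. q a k * q b k)"

text \<open>The derivative of \<open>\<Psi>\<close> on the open unit interval, with the factors
  \<open>1 / sqrt t\<close> and \<open>1 / sqrt (1 - t)\<close> already cancelled; hence it is
  continuous up to the endpoints.\<close>

definition \<Psi>' :: "real \<Rightarrow> real" where
  "\<Psi>' t = - ((s * \<beta>)\<^sup>2 / 2) * (\<Sum>a\<in>I \<times> J. \<Sum>b\<in>I \<times> J. cov_diff a b *
     (\<integral>g. weight (gauss_field (coef t) g) a * weight (gauss_field (coef t) g) b \<partial>gauss_space))"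

lemma \<Psi>'_nonpos: "\<Psi>' t \<le> 0"
proof -
  have "0 \<le> (\<Sum>a\<in>I \<times> J. \<Sum>b\<in>I \<times> J. cov_diff a b *
     (\<integral>g. weight (gauss_field (coef t) g) a * weight (gauss_field (coef t) g) b \<partial>gauss_space))"
    using cov_le by (intro sum_nonneg mult_nonneg_nonneg Bochner_Integration.integral_nonneg)
      (auto simp: cov_diff_def weight_nonneg)
  then show ?thesis unfolding \<Psi>'_def by simp
qed

lemma coef_tendsto: "((\<lambda>t. coef t a k) \<longlongrightarrow> coef t0 a k) (at t0 within S)"
  unfolding coef_def by (intro tendsto_intros)

lemma continuous_on_\<Psi>: "continuous_on S \<Psi>"
  unfolding continuous_on_def \<Psi>_def
  by (intro ballI tendsto_expectation_ln_partition coef_tendsto)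

lemma continuous_on_\<Psi>': "continuous_on S \<Psi>'"
proof -
  note [measurable] = measurable_weight_field
  have "((\<lambda>t. \<integral>g. weight (gauss_field (coef t) g) a * weight (gauss_field (coef t) g) b \<partial>gauss_space)
     \<longlongrightarrow> (\<integral>g. weight (gauss_field (coef t0) g) a * weight (gauss_field (coef t0) g) b \<partial>gauss_space)) (at t0 within S)"
    if "a \<in> I \<times> J" "b \<in> I \<times> J" for a b t0
  \<comment> \<open>Products of weights lie between \<open>0\<close> and \<open>1\<close>, and the
    measure is a probability.\<close>
  proof (rule tendsto_integral_dominated[where w = "\<lambda>_. 1"])
    show "((\<lambda>t. weight (gauss_field (coef t) g) a * weight (gauss_field (coef t) g) b)
        \<longlongrightarrow> weight (gauss_field (coef t0) g) a * weight (gauss_field (coef t0) g) b) (at t0 within S)" for g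
      using that by (intro tendsto_mult tendsto_weight tendsto_gauss_field coef_tendsto)
    show "\<forall>\<^sub>F t in at t0 within S. \<forall>g. \<bar>weight (gauss_field (coef t) g) a * weight (gauss_field (coef t) g) b\<bar> \<le> 1"
      using that weight_le_1 weight_nonneg
      by (auto intro!: always_eventually mult_le_one)
  qed (use that in measurable)
  then show ?thesis
    unfolding continuous_on_def \<Psi>'_def by (intro ballI tendsto_intros)
qed

lemma DERIV_\<Psi>:
  assumes "0 < t" "t < 1"
  shows "(\<Psi> has_real_derivative \<Psi>' t) (at t)"
proof -
  define c' where "c' a k = p a k / (2 * sqrt t) - q a k / (2 * sqrt (1 - t))" for a k
  have "((\<lambda>t. coef t a k) has_real_derivative c' a k) (at t)" for a k
    unfolding coef_def c'_def using assms
    by (auto intro!: derivative_eq_intros simp: field_simps)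
  then have "(\<Psi> has_real_derivative s * \<beta> * (\<Sum>a\<in>I \<times> J. \<Sum>b\<in>I \<times> J. (\<Sum>k\<in>UNIV. c' a k * coef t b k) *
      (\<integral>g. dweight (gauss_field (coef t) g) a b \<partial>gauss_space))) (at t)"
    unfolding \<Psi>_def by (intro DERIV_expectation_ln_partition)
  also have "s * \<beta> * (\<Sum>a\<in>I \<times> J. \<Sum>b\<in>I \<times> J. (\<Sum>k\<in>UNIV. c' a k * coef t b k) *
      (\<integral>g. dweight (gauss_field (coef t) g) a b \<partial>gauss_space)) = \<Psi>' t"
  proof -
    have cov: "(\<Sum>k\<in>UNIV. c' a k * coef t b k) = cov_diff a b / 2" for a b
    proof -
      have "c' a k * coef t b k = (p a k * p b k - q a k * q b k) / 2" for k
      proof -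
        \<comment> \<open>The singular ratios of square roots occur only in the cross terms of
          \<open>p\<close> and \<open>q\<close>, which vanish by
          \<open>disjoint_support\<close>.\<close>
        have "c' a k * coef t b k = (p a k * p b k - q a k * q b k) / 2
          + (sqrt (1 - t) / sqrt t * (p a k * q b k) - sqrt t / sqrt (1 - t) * (p b k * q a k)) / 2"
        proof -
          define u v where "u = sqrt t" and "v = sqrt (1 - t)"
          have "u > 0" "v > 0" using assms by (auto simp: u_def v_def)
          then show ?thesis
            unfolding c'_def coef_def u_def[symmetric] v_def[symmetric] by (simp add: field_simps)
        qed
        then show ?thesis using disjoint_support by simp
      qed
      then show ?thesis
        by (simp only: cov_diff_def sum_divide_distrib[symmetric] sum_subtractf)
    qed
    \<comment> \<open>Within a row \<open>cov_diff\<close> is zero; across rows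
      \<open>dweight\<close> is \<open>- (\<beta> * s)\<close> times the product of the two
      weights.\<close>
    have term_eq: "cov_diff a b / 2 * (\<integral>g. dweight (gauss_field (coef t) g) a b \<partial>gauss_space)
      = - (s * \<beta> / 2) * (cov_diff a b *
        (\<integral>g. weight (gauss_field (coef t) g) a * weight (gauss_field (coef t) g) b \<partial>gauss_space))" for a b
    proof (cases "fst a = fst b")
      case True
      then show ?thesis by (simp add: cov_diff_def cov_row)
    next
      case False
      have "(\<integral>g. dweight (gauss_field (coef t) g) a b \<partial>gauss_space) = (\<integral>g. - (\<beta> * s) *
          (weight (gauss_field (coef t) g) a * weight (gauss_field (coef t) g) b) \<partial>gauss_space)"
        by (simp add: dweight_off_row[OF False] mult.assoc)
      then show ?thesis by simp
    qed
    show ?thesis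
      unfolding cov term_eq \<Psi>'_def sum_distrib_left[symmetric] by (simp add: power2_eq_square)
  qed
  finally show ?thesis .
qed

lemma \<Psi>_FTC:
  assumes "0 \<le> a" "a \<le> b" "b \<le> 1"
  shows "set_integrable lborel {a<..<b} \<Psi>'" and "(LBINT t:{a<..<b}. \<Psi>' t) = \<Psi> b - \<Psi> a"
  using assms FTC_nonpos_deriv[OF continuous_on_\<Psi> DERIV_\<Psi> continuous_on_\<Psi>' \<Psi>'_nonpos, of a b] by auto

lemma \<Psi>_antimono:
  assumes "0 \<le> a" "a \<le> b" "b \<le> 1"
  shows "\<Psi> b \<le> \<Psi> a"
proof (rule DERIV_nonpos_imp_decreasing_open[OF assms(2) _ continuous_on_\<Psi>])
  fix t assume "a < t" "t < b"
  then show "\<exists>y. (\<Psi> has_real_derivative y) (at t) \<and> y \<le> 0"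
    using assms DERIV_\<Psi>[of t] \<Psi>'_nonpos[of t] by auto
qed

end

section \<open>The lifted bilinear process\<close>

lemma UNIV_gauss_index:
  "(UNIV :: ('m, 'n) gauss_index set) =
    range (\<lambda>(i, j). Entry_G i j) \<union> {Entry_u4} \<union> range Entry_u2 \<union> range Entry_h"
  by (auto simp: image_iff) (metis gauss_index.exhaust)

instance gauss_index :: (finite, finite) finite
  by standard (simp add: UNIV_gauss_index)

lemma sum_gauss_index:
  fixes f :: "('m::finite, 'n::finite) gauss_index \<Rightarrow> real"
  shows "(\<Sum>k\<in>UNIV. f k) = (\<Sum>i\<in>UNIV. \<Sum>j\<in>UNIV. f (Entry_G i j)) + f Entry_u4
    + (\<Sum>i\<in>UNIV. f (Entry_u2 i)) + (\<Sum>j\<in>UNIV. f (Entry_h j))"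
proof -
  have "(\<Sum>k\<in>range (\<lambda>(i, j). Entry_G i j). f k) = (\<Sum>i\<in>UNIV. \<Sum>j\<in>UNIV. f (Entry_G i j))"
    by (subst sum.reindex) (auto simp: inj_on_def sum.cartesian_product case_prod_unfold)
  moreover have "(\<Sum>k\<in>range Entry_u2. f k) = (\<Sum>i\<in>UNIV. f (Entry_u2 i))"
    and "(\<Sum>k\<in>range Entry_h. f k) = (\<Sum>j\<in>UNIV. f (Entry_h j))"
    by (auto simp: sum.reindex inj_on_def)
  ultimately show ?thesis
    unfolding UNIV_gauss_index by (subst sum.union_disjoint, simp, simp, force)+ simp
qed

text \<open>The coefficients of \<open>sqrt t\<close> and of \<open>sqrt (1 - t)\<close> in \<open>interp_H\<close>.\<close>

fun coupled_coef :: "(nat \<Rightarrow> real ^ 'n) \<Rightarrow> (nat \<Rightarrow> real ^ 'm) \<Rightarrow> nat \<times> nat \<Rightarrow> ('m, 'n) gauss_index \<Rightarrow> real" where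
  "coupled_coef x y (i1, i2) (Entry_G i j) = y i2 $ i * x i1 $ j"
| "coupled_coef x y (i1, i2) Entry_u4 = norm (x i1) * norm (y i2)"
| "coupled_coef x y (i1, i2) (Entry_u2 i) = 0"
| "coupled_coef x y (i1, i2) (Entry_h j) = 0"

fun decoupled_coef :: "(nat \<Rightarrow> real ^ 'n) \<Rightarrow> (nat \<Rightarrow> real ^ 'm) \<Rightarrow> nat \<times> nat \<Rightarrow> ('m, 'n) gauss_index \<Rightarrow> real" where
  "decoupled_coef x y (i1, i2) (Entry_G i j) = 0"
| "decoupled_coef x y (i1, i2) Entry_u4 = 0"
| "decoupled_coef x y (i1, i2) (Entry_u2 i) = norm (x i1) * y i2 $ i"
| "decoupled_coef x y (i1, i2) (Entry_h j) = norm (y i2) * x i1 $ j"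

lemma coupled_decoupled: "coupled_coef x y a k * decoupled_coef x y b k = 0"
  by (cases a; cases b; cases k) auto

section \<open>Covariances of the lifted process\<close>

lemma cov_coupled:
  "(\<Sum>k\<in>UNIV. coupled_coef x y (i1, i2) k * coupled_coef x y (j1, j2) k)
    = (y i2 \<bullet> y j2) * (x i1 \<bullet> x j1) + norm (x i1) * norm (x j1) * (norm (y i2) * norm (y j2))"
  by (simp add: sum_gauss_index inner_vec_def sum_product mult_ac)

lemma cov_decoupled:
  "(\<Sum>k\<in>UNIV. decoupled_coef x y (i1, i2) k * decoupled_coef x y (j1, j2) k)
    = norm (x i1) * norm (x j1) * (y i2 \<bullet> y j2) + norm (y i2) * norm (y j2) * (x i1 \<bullet> x j1)"
  by (simp add: sum_gauss_index inner_vec_def sum_distrib_left mult_ac)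

text \<open>The term with \<open>u4\<close> contributes the product of all four norms, which is what
  completes the difference to a product of two Cauchy-Schwarz gaps.\<close>

lemma cov_coupled_minus_decoupled:
  "(\<Sum>k\<in>UNIV. coupled_coef x y (i1, i2) k * coupled_coef x y (j1, j2) k)
   - (\<Sum>k\<in>UNIV. decoupled_coef x y (i1, i2) k * decoupled_coef x y (j1, j2) k)
   = (norm (x i1) * norm (x j1) - x i1 \<bullet> x j1) * (norm (y i2) * norm (y j2) - y i2 \<bullet> y j2)"
  unfolding cov_coupled cov_decoupled by (simp add: algebra_simps)

text \<open>Both gaps are nonnegative, and within a row the gap of the \<open>x\<close> vectors is
  zero because the two vectors coincide.\<close>

lemma gauss_comparison_coupled:
  assumes "l \<ge> 1" "\<beta> > 0"
  shows "gauss_comparison {1..l} {1..l} \<beta> (coupled_coef x y) (decoupled_coef x y)"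
proof unfold_locales
  fix a b :: "nat \<times> nat"
  obtain i1 i2 j1 j2 where ab: "a = (i1, i2)" "b = (j1, j2)" by (cases a, cases b)
  have "0 \<le> (norm (x i1) * norm (x j1) - x i1 \<bullet> x j1) * (norm (y i2) * norm (y j2) - y i2 \<bullet> y j2)"
    using norm_cauchy_schwarz[of "x i1" "x j1"] norm_cauchy_schwarz[of "y i2" "y j2"] by simp
  then show "(\<Sum>k\<in>UNIV. decoupled_coef x y a k * decoupled_coef x y b k)
      \<le> (\<Sum>k\<in>UNIV. coupled_coef x y a k * coupled_coef x y b k)"
    unfolding ab by (simp add: cov_coupled_minus_decoupled[symmetric])
  show "(\<Sum>k\<in>UNIV. coupled_coef x y a k * coupled_coef x y b k)
      = (\<Sum>k\<in>UNIV. decoupled_coef x y a k * decoupled_coef x y b k)" if "fst a = fst b"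
    using that cov_coupled_minus_decoupled[of x y i1 i2 j1 j2]
    by (simp add: ab norm_eq_sqrt_inner)
  show "coupled_coef x y a k * decoupled_coef x y b k = 0" for k
    by (rule coupled_decoupled)
qed (use assms in auto)

section \<open>Transfer between the given probability space and the product space\<close>

lemma interp_H_eq:
  "interp_H (G \<omega>) (u4 \<omega>) (u2 \<omega>) (h \<omega>) t (x i1) (y i2)
    = gauss_field (\<lambda>a k. sqrt t * coupled_coef x y a k + sqrt (1 - t) * decoupled_coef x y a k)
        (\<lambda>k. gauss_entry G u4 u2 h k \<omega>) (i1, i2)"
proof -
  have "y i2 \<bullet> (G \<omega> *v x i1) = (\<Sum>i\<in>UNIV. \<Sum>j\<in>UNIV. y i2 $ i * x i1 $ j * G \<omega> $ i $ j)"
    by (simp add: inner_vec_def matrix_vector_mult_def sum_distrib_left mult_ac)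
  moreover have "y i2 \<bullet> u2 \<omega> = (\<Sum>i\<in>UNIV. y i2 $ i * u2 \<omega> $ i)"
    and "h \<omega> \<bullet> x i1 = (\<Sum>j\<in>UNIV. x i1 $ j * h \<omega> $ j)"
    by (simp_all add: inner_vec_def mult.commute)
  ultimately show ?thesis
    unfolding interp_H_def gauss_field_def sum_gauss_index
    by (simp add: gauss_entry_def sum_distrib_left mult_ac)
qed

text \<open>The joint law of an independent family is the product of its marginals, here all
  standard normal.\<close>

lemma distr_gauss_entry:
  fixes G :: "'w \<Rightarrow> real ^ 'n ^ 'm"
  assumes "prob_space M" and iid: "iid_std_normal M G u4 u2 h"
  shows "(\<lambda>\<omega> k. gauss_entry G u4 u2 h k \<omega>) \<in> M \<rightarrow>\<^sub>M gauss_space"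
    and "distr M gauss_space (\<lambda>\<omega> k. gauss_entry G u4 u2 h k \<omega>) = gauss_space"
proof -
  interpret prob_space M by fact
  let ?X = "gauss_entry G u4 u2 h"
  have X: "?X k \<in> borel_measurable M" and dX: "distr M lborel (?X k) = std_normal_distribution" for k
    using iid by (auto simp: iid_std_normal_def distributed_def)
  have sets: "sets (gauss_space :: (('m, 'n) gauss_index \<Rightarrow> real) measure) = sets (\<Pi>\<^sub>M k\<in>UNIV. borel)"
    unfolding gauss_space_def by (intro sets_PiM_cong) auto
  show "(\<lambda>\<omega> k. ?X k \<omega>) \<in> M \<rightarrow>\<^sub>M gauss_space"
    unfolding measurable_cong_sets[OF refl sets] using X
    by (intro measurable_PiM_single') auto
  \<comment> \<open>The density is given relative to \<open>lborel\<close>, independence relative to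
    \<open>borel\<close>; both have the same measurable sets, so the laws agree.\<close>
  have dX': "distr M borel (?X k) = std_normal_distribution" for k
    unfolding dX[of k, symmetric] by (intro distr_cong) auto
  have "indep_vars (\<lambda>_. borel) ?X UNIV"
    using iid by (simp add: iid_std_normal_def)
  then have "distr M (\<Pi>\<^sub>M k\<in>UNIV. borel) (\<lambda>\<omega>. \<lambda>k\<in>UNIV. ?X k \<omega>) = (\<Pi>\<^sub>M k\<in>UNIV. distr M borel (?X k))"
    using X by (subst (asm) indep_vars_iff_distr_eq_PiM') auto
  then have "distr M (\<Pi>\<^sub>M k\<in>UNIV. borel) (\<lambda>\<omega> k. ?X k \<omega>) = gauss_space"
    by (simp add: gauss_space_def dX' restrict_def)
  then show "distr M gauss_space (\<lambda>\<omega> k. ?X k \<omega>) = gauss_space"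
    by (simp cong: distr_cong add: sets)
qed

text \<open>Expectation, \<open>deriv\<close> and the set integral are total functions with default
  values; the integrability and differentiability claims ensure that the identity and the
  inequalities speak about genuine expectations, derivatives and integrals.\<close>

theorem corollary1:
  fixes M :: "'w measure"
    and G :: "'w \<Rightarrow> real ^ 'n ^ 'm" and u4 :: "'w \<Rightarrow> real"
    and u2 :: "'w \<Rightarrow> real ^ 'm" and h :: "'w \<Rightarrow> real ^ 'n"
    and l :: nat and x :: "nat \<Rightarrow> real ^ 'n" and y :: "nat \<Rightarrow> real ^ 'm"
    and \<beta> s :: real
  assumes "prob_space M"
    and "iid_std_normal M G u4 u2 h"
    and "l \<ge> 1" and "\<beta> > 0" and "s \<noteq> 0"
  defines "\<psi> \<equiv> psi M G u4 u2 h l x y \<beta> s"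
  shows "(\<forall>t\<in>{0..1}. integrable M (\<lambda>\<omega>. log_partition l x y \<beta> s t (G \<omega>) (u4 \<omega>) (u2 \<omega>) (h \<omega>))) \<and>
    (\<forall>\<tau>\<in>{0<..<1}. \<psi> differentiable at \<tau>) \<and>
    (\<forall>t\<in>{0..1}.
       set_integrable lborel {0<..<t} (deriv \<psi>) \<and>
       \<psi> t = \<psi> 0 + (LBINT \<tau>:{0<..<t}. deriv \<psi> \<tau>) \<and>
       \<psi> 0 \<ge> \<psi> t \<and> \<psi> t \<ge> \<psi> 1)"
proof -
  interpret gc: gauss_comparison "{1..l}" "{1..l}" \<beta> s "coupled_coef x y" "decoupled_coef x y"
    by (rule gauss_comparison_coupled) fact+
  let ?X = "\<lambda>\<omega> k. gauss_entry G u4 u2 h k \<omega>"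
  let ?L = "\<lambda>t g. ln (gc.partition (gauss_field (gc.coef t) g))"
  define c where "c = 1 / (\<beta> * \<bar>s\<bar> * sqrt (real CARD('n)))"
  have "c \<ge> 0" using \<open>\<beta> > 0\<close> by (simp add: c_def)
  note X = distr_gauss_entry[OF assms(1,2)]
  have L: "log_partition l x y \<beta> s t (G \<omega>) (u4 \<omega>) (u2 \<omega>) (h \<omega>) = ?L t (?X \<omega>)" for t \<omega>
    unfolding log_partition_def gc.partition_def gc.row_def interp_H_eq gc.coef_def[abs_def] by simp
  have int: "integrable M (\<lambda>\<omega>. ?L t (?X \<omega>))" for t
    by (rule integrable_distr[OF X(1), unfolded X(2)]) (rule gc.integrable_ln_partition_field)
  \<comment> \<open>Transport to the product space makes \<open>\<psi>\<close> a nonnegative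
    multiple of \<open>gc.\<Psi>\<close>, so every claim reduces to that function.\<close>
  have psi_eq: "\<psi> = (\<lambda>t. c * gc.\<Psi> t)"
  proof
    fix t
    have "gc.\<Psi> t = (\<integral>\<omega>. ?L t (?X \<omega>) \<partial>M)"
      unfolding gc.\<Psi>_def
      by (rule integral_distr[OF X(1), unfolded X(2)]) (rule borel_measurable_integrable[OF gc.integrable_ln_partition_field])
    then show "\<psi> t = c * gc.\<Psi> t"
      unfolding \<psi>_def psi_def L c_def by simp
  qed
  have deriv: "(\<psi> has_real_derivative c * gc.\<Psi>' t) (at t)" if "0 < t" "t < 1" for t
    unfolding psi_eq using that by (intro DERIV_cmult gc.DERIV_\<Psi>)
  have "set_integrable lborel {0<..<t} (deriv \<psi>) \<and>
       \<psi> t = \<psi> 0 + (LBINT \<tau>:{0<..<t}. deriv \<psi> \<tau>) \<and> \<psi> 0 \<ge> \<psi> t \<and> \<psi> t \<ge> \<psi> 1"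
    if t: "t \<in> {0..1}" for t
  proof (intro conjI)
    \<comment> \<open>The derivative is identified only inside the open interval, which is all that
      the integral over \<open>{0<..<t}\<close> sees.\<close>
    have eq: "deriv \<psi> \<tau> = c * gc.\<Psi>' \<tau>" if "\<tau> \<in> {0<..<t}" for \<tau>
      using that t by (intro DERIV_imp_deriv deriv) auto
    have FTC: "set_integrable lborel {0<..<t} gc.\<Psi>'" "(LBINT \<tau>:{0<..<t}. gc.\<Psi>' \<tau>) = gc.\<Psi> t - gc.\<Psi> 0"
      using t gc.\<Psi>_FTC[of 0 t] by simp_all
    show "set_integrable lborel {0<..<t} (deriv \<psi>)"
      using FTC(1) by (subst set_integrable_cong[OF refl refl eq]) auto
    have "(LBINT \<tau>:{0<..<t}. deriv \<psi> \<tau>) = (LBINT \<tau>:{0<..<t}. c * gc.\<Psi>' \<tau>)"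
      using eq by (intro set_lebesgue_integral_cong) auto
    also have "\<dots> = c * (LBINT \<tau>:{0<..<t}. gc.\<Psi>' \<tau>)"
      by (rule set_integral_mult_right)
    also have "\<dots> = \<psi> t - \<psi> 0"
      unfolding FTC(2) psi_eq by (rule right_diff_distrib)
    finally show "\<psi> t = \<psi> 0 + (LBINT \<tau>:{0<..<t}. deriv \<psi> \<tau>)"
      by simp
    show "\<psi> 0 \<ge> \<psi> t"
      unfolding psi_eq by (rule mult_left_mono[OF gc.\<Psi>_antimono \<open>c \<ge> 0\<close>]) (use t in auto)
    show "\<psi> t \<ge> \<psi> 1"
      unfolding psi_eq by (rule mult_left_mono[OF gc.\<Psi>_antimono \<open>c \<ge> 0\<close>]) (use t in auto)
  qed
  moreover have "\<psi> differentiable at \<tau>" if "\<tau> \<in> {0<..<1}" for \<tau>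
    unfolding real_differentiable_def using that by (intro exI[of _ "c * gc.\<Psi>' \<tau>"] deriv) auto
  ultimately show ?thesis
    unfolding L using int by blast
qed

end
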